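(* Let $q$ be a power of $2$, let $n$ be a positive integer, let $L_0$ and $L_1$ be $q$-linear polynomials over $\mathbb F_{q^n}$, and let $l$ be a nonnegative integer. Then $L_0\big(x^{2^l}\big)+L_1(x)\mathrm{Tr}(x)$ is a permutation polynomial of $\mathbb F_{q^n}$ if and only if, for every $u\in\mathbb F_{q^n}^*$, at least one of the following holds: \begin{itemize} \item $L_1^\prime(u)\in\mathbb F_q$ and $L_0^\prime(u)^2+L_1^\prime(u)^{2^l}\ne0$; \item $1,L_0^\prime(u),L_1^\prime(u)^{2^l}$ are linearly independent over $\mathbb F_q$. \end{itemize}
   Context: $\mathrm{Tr}$ is the trace map of $\mathbb F_{q^n}/\mathbb F_q$, so $\mathrm{Tr}(x)=\sum_{i=0}^{n-1}x^{q^i}$. A $q$-linear polynomial over $\mathbb F_{q^n}$ is a polynomial of the form $L(x)=\sum_ia_ix^{q^i}$ with $a_i\in\mathbb F_{q^n}$; polynomials are identified with the maps they induce on $\mathbb F_{q^n}$ (so $x^{q^n}=x$). For such $L$, define $L^\prime(x)=\sum_i(a_ix)^{q^{-i}}$, where $x\mapsto x^{q^{-1}}$ denotes the inverse of the automorphism $x\mapsto x^q$ of $\mathbb F_{q^n}$ (and $x\mapsto x^{q^{-i}}$ is its $i$-th iterate). A permutation polynomial of $\mathbb F_{q^n}$ is a polynomial over $\mathbb F_{q^n}$ whose induced map on $\mathbb F_{q^n}$ is a bijection. *)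

theory Defs
  imports Complex_Main "HOL-Library.Cardinality" "HOL-Computational_Algebra.Polynomial"
begin

text \<open>
  The field with \<open>q\<^sup>n\<close> elements is a type \<open>'a\<close> of sort \<open>{field, finite}\<close> with
  \<open>CARD('a) = q ^ n\<close>, and the field with \<open>q\<close> elements is a subfield of it, given as a set.
\<close>

definition is_subfield :: "'a::field set \<Rightarrow> bool" where
  "is_subfield K \<longleftrightarrow> 0 \<in> K \<and> 1 \<in> K \<and>
     (\<forall>x\<in>K. \<forall>y\<in>K. x + y \<in> K \<and> x * y \<in> K) \<and>
     (\<forall>x\<in>K. - x \<in> K \<and> inverse x \<in> K)"

text \<open>Independence of the family \<open>vs\<close>, so a list with a repeated entry is dependent.\<close>

definition lin_indep_over :: "'a::field set \<Rightarrow> 'a list \<Rightarrow> bool" where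
  "lin_indep_over K vs \<longleftrightarrow>
     (\<forall>c. (\<forall>i<length vs. c i \<in> K) \<and> (\<Sum>i<length vs. c i * vs ! i) = 0
        \<longrightarrow> (\<forall>i<length vs. c i = 0))"

definition trace_poly :: "nat \<Rightarrow> nat \<Rightarrow> 'a::field poly" where
  "trace_poly q n = (\<Sum>i<n. monom 1 (q ^ i))"

definition q_linear :: "nat \<Rightarrow> 'a::field poly \<Rightarrow> bool" where
  "q_linear q L \<longleftrightarrow> (\<exists>m a. L = (\<Sum>i<m. monom (a i) (q ^ i)))"

definition permutation_poly :: "'a::field poly \<Rightarrow> bool" where
  "permutation_poly p \<longleftrightarrow> bij (poly p)"

text \<open>
  The map \<open>L'(x) = (\<Sum>i. (a\<^sub>i x) ^ (q ^ (- i)))\<close> for \<open>L(x) = (\<Sum>i. a\<^sub>i x ^ (q ^ i))\<close>.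
  For \<open>q \<ge> 2\<close> we have \<open>a\<^sub>i = coeff L (q ^ i)\<close>, which vanishes for \<open>i > degree L\<close> because
  \<open>q ^ i > i\<close>; see \<open>q_adjoint_eq\<close> below.
\<close>

definition q_adjoint :: "nat \<Rightarrow> 'a::field poly \<Rightarrow> 'a \<Rightarrow> 'a" where
  "q_adjoint q L x = (\<Sum>i\<le>degree L. (inv (\<lambda>y. y ^ q) ^^ i) (coeff L (q ^ i) * x))"

lemma q_adjoint_eq:
  fixes a :: "nat \<Rightarrow> 'a::field"
  assumes q: "q \<ge> 2" and bij: "bij (\<lambda>y::'a. y ^ q)"
  shows "q_adjoint q (\<Sum>i<m. monom (a i) (q ^ i)) x = (\<Sum>i<m. (inv (\<lambda>y. y ^ q) ^^ i) (a i * x))"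
proof -
  let ?L = "\<Sum>i<m. monom (a i) (q ^ i)"
  let ?g = "\<lambda>i. inv (\<lambda>y::'a. y ^ q) ^^ i"
  have c: "coeff ?L (q ^ i) = (if i < m then a i else 0)" for i
  proof -
    have "q ^ j = q ^ i \<longleftrightarrow> j = i" for j
      using q by (intro power_inject_exp) auto
    then show ?thesis by (simp add: coeff_sum)
  qed
  have "inv (\<lambda>y::'a. y ^ q) 0 = 0"
    using bij q by (intro inv_f_eq) (auto simp: bij_is_inj)
  then have g0: "?g i 0 = 0" for i
    by (induction i) auto
  have z: "coeff ?L (q ^ i) = 0" if "i > degree ?L" for i
  proof (rule coeff_eq_0)
    have "i < q ^ i" using q by (intro less_exp[THEN less_le_trans] power_mono) auto
    then show "degree ?L < q ^ i" using that by linarith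
  qed
  let ?N = "max m (Suc (degree ?L))"
  have "q_adjoint q ?L x = (\<Sum>i<?N. ?g i (coeff ?L (q ^ i) * x))"
    unfolding q_adjoint_def by (rule sum.mono_neutral_left) (auto simp: z g0)
  also have "\<dots> = (\<Sum>i<m. ?g i (coeff ?L (q ^ i) * x))"
    by (rule sum.mono_neutral_right) (auto simp: c g0)
  also have "\<dots> = (\<Sum>i<m. ?g i (a i * x))"
    by (rule sum.cong) (auto simp: c)
  finally show ?thesis .
qed

end

theory Submission
  imports Defs "HOL-Library.FuncSet"
begin

text \<open>
  A map \<open>f\<close> of a finite field permutes it iff \<open>\<Sum>x. \<chi> (u * f x) = 0\<close> for all \<open>u \<noteq> 0\<close>, where
  \<open>\<chi> = \<psi> \<circ> Tr\<close> is an additive character of order 2 and \<open>\<psi> = (- 1) ^ tr2\<close> that of the subfield \<open>K\<close>.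
  Moving \<open>L\<^sub>0\<close> and \<open>L\<^sub>1\<close> to their adjoints and substituting \<open>y = x ^ (2 ^ l)\<close> turns this sum into
  \<open>\<Sum>y. \<psi> (Tr (a y) + Tr y * Tr (B y))\<close> with \<open>a = L\<^sub>0' u\<close> and \<open>B = (L\<^sub>1' u) ^ (2 ^ l)\<close>. If \<open>B \<in> K\<close>, it is
  the sum of the linear character \<open>\<chi> ((a + \<surd>B) y)\<close>. If \<open>1, a, B\<close> are independent over \<open>K\<close>,
  some translation of \<open>y\<close> flips its sign. If \<open>a = \<alpha> + \<beta> B\<close> with \<open>B \<notin> K\<close>, a translation absorbs
  the linear part, and the remaining sum \<open>\<Sum>y. \<psi> (Tr y * Tr (B y))\<close> is positive.
\<close>

section \<open>Finite field preliminaries\<close>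

lemma subfield_power_card:
  fixes K :: "'a::{field, finite} set"
  assumes K: "is_subfield K" and x: "x \<in> K"
  shows "x ^ card K = x"
proof (cases "x = 0")
  case True
  have "card K > 0" using x by (auto simp: card_gt_0_iff)
  then show ?thesis using True by simp
next
  case False
  let ?U = "K - {0}"
  have inv: "inverse x \<in> K" using K x by (simp add: is_subfield_def)
  have "bij_betw ((*) x) ?U ?U"
  proof (rule bij_betwI[where g = "(*) (inverse x)"])
    show "(*) x \<in> ?U \<rightarrow> ?U" "(*) (inverse x) \<in> ?U \<rightarrow> ?U"
      using K x inv False by (auto simp: is_subfield_def)
  qed (use False in auto)
  \<comment> \<open>Multiplication by \<open>x\<close> permutes the nonzero elements of
    \<open>K\<close>, so their product is unchanged by it and the factor \<open>x ^ card ?U\<close>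
    must be 1.\<close>
  then have "prod (\<lambda>y. y) ?U = (\<Prod>y\<in>?U. x * y)"
    by (rule prod.reindex_bij_betw[symmetric])
  also have "\<dots> = x ^ card ?U * prod (\<lambda>y. y) ?U"
    by (simp add: prod.distrib)
  finally have "x ^ card ?U = 1" by simp
  moreover have "card K = Suc (card ?U)"
    using K by (intro card.remove) (auto simp: is_subfield_def)
  ultimately show ?thesis by simp
qed

text \<open>The polynomial has degree at most \<open>c ^ (N - 1)\<close> and is nonzero because its
  linear coefficient is 1. Taking \<open>q\<close>, \<open>n\<close> for \<open>c\<close>,
  \<open>N\<close> shows that \<open>Tr\<close> is not identically zero; taking 2, \<open>m\<close>
  shows that \<open>tr2\<close> does not vanish on all of \<open>K\<close>.\<close>

lemma card_roots_sum_powers: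
  fixes c N :: nat
  assumes c: "c \<ge> 2" and N: "N \<ge> 1"
  shows "card {x :: 'a::{field, finite}. (\<Sum>i<N. x ^ (c ^ i)) = 0} < c ^ N"
proof -
  let ?p = "\<Sum>i<N. monom (1::'a) (c ^ i)"
  have "coeff ?p 1 = (\<Sum>i<N. if i = 0 then 1 else 0)"
    unfolding coeff_sum using c by (intro sum.cong) (auto simp: nat_power_eq_Suc_0_iff)
  also have "\<dots> = 1" using N by simp
  finally have p0: "?p \<noteq> 0" by (metis coeff_0 zero_neq_one)
  have "degree ?p \<le> c ^ (N - 1)"
  proof (rule degree_sum_le)
    fix i assume "i \<in> {..<N}"
    then have "c ^ i \<le> c ^ (N - 1)" using c by (intro power_increasing) auto
    then show "degree (monom (1::'a) (c ^ i)) \<le> c ^ (N - 1)"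
      using degree_monom_le le_trans by blast
  qed simp
  moreover have "c ^ (N - 1) < c ^ N" using c N by (intro power_strict_increasing) auto
  moreover have "card {x. poly ?p x = 0} \<le> degree ?p"
    by (rule card_poly_roots_bound[OF p0])
  ultimately show ?thesis by (simp add: poly_sum poly_monom)
qed

section \<open>Characteristic 2 and the subfield \<open>K\<close>\<close>

locale even_field_extension =
  fixes K :: "'a::{field, finite} set" and q m n :: nat
  assumes m: "m \<ge> 1" and q_def: "q = 2 ^ m" and n: "n \<ge> 1"
    and card_UNIV: "CARD('a) = q ^ n"
    and subfield: "is_subfield K" and card_K: "card K = q"
begin

lemma K_0 [simp]: "0 \<in> K" and K_1 [simp]: "1 \<in> K"
  and K_add [intro, simp]: "x \<in> K \<Longrightarrow> y \<in> K \<Longrightarrow> x + y \<in> K"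
  and K_mult [intro, simp]: "x \<in> K \<Longrightarrow> y \<in> K \<Longrightarrow> x * y \<in> K"
  and K_inverse [intro, simp]: "x \<in> K \<Longrightarrow> inverse x \<in> K"
  using subfield by (auto simp: is_subfield_def)

lemma K_power [intro, simp]: "x \<in> K \<Longrightarrow> x ^ k \<in> K"
  by (induction k) auto

lemma K_divide [intro, simp]: "x \<in> K \<Longrightarrow> y \<in> K \<Longrightarrow> x / y \<in> K"
  by (simp add: divide_inverse)

lemma q_ge_2: "q \<ge> 2"
  using m power_increasing[of 1 m "2::nat"] by (simp add: q_def)

lemma power_q_power_n: "(x::'a) ^ (q ^ n) = x"
  using subfield_power_card[of UNIV x] by (simp add: is_subfield_def card_UNIV)

text \<open>The polynomial \<open>x ^ q - x\<close> has at most \<open>q\<close> roots, and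
  \<open>K\<close> already supplies \<open>q\<close> of them.\<close>

lemma K_iff: "x \<in> K \<longleftrightarrow> x ^ q = x"
proof -
  let ?p = "monom (1::'a) q - monom 1 1"
  have "coeff ?p 1 = - 1" using q_ge_2 by simp
  then have p0: "?p \<noteq> 0" by (metis coeff_0 neg_equal_0_iff_equal zero_neq_one)
  have "degree ?p \<le> q"
    by (intro degree_diff_le order_trans[OF degree_monom_le]) (use q_ge_2 in auto)
  then have "card {x. poly ?p x = 0} \<le> q"
    using card_poly_roots_bound[OF p0] by linarith
  then have "card {x::'a. x ^ q = x} \<le> card K"
    by (simp add: poly_monom card_K)
  moreover have "K \<subseteq> {x. x ^ q = x}"
    using subfield_power_card[OF subfield] by (auto simp: card_K)
  ultimately have "K = {x. x ^ q = x}" by (intro card_seteq) auto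
  then show ?thesis by blast
qed

text \<open>Adding 1 to every element permutes the field, so the sum of all elements forces
  \<open>CARD('a)\<close> times 1 to be 0; this cardinality is a power of 2.\<close>

lemma two_eq_0: "(2::'a) = 0"
proof -
  have "(\<Sum>x\<in>UNIV. x) = (\<Sum>x\<in>UNIV. x + (1::'a))"
    by (rule sum.reindex_bij_betw[symmetric]) (rule bij_betwI[where g = "\<lambda>x. x - 1"], auto)
  then have "of_nat CARD('a) = (0::'a)" by (simp add: sum.distrib)
  then show ?thesis by (simp add: card_UNIV q_def)
qed

lemma add_self [simp]: "x + x = (0::'a)"
  by (metis mult_2 mult_zero_left two_eq_0)

lemma add_eq_0_iff_eq: "x + y = 0 \<longleftrightarrow> x = (y::'a)"
  by (metis add_self add_left_cancel)

lemma power_two_power_add: "(x + y) ^ (2 ^ k) = x ^ (2 ^ k) + (y::'a) ^ (2 ^ k)"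
  by (induction k) (simp_all add: power_mult mult.commute[of 2] power2_sum two_eq_0)

lemma power_two_power_sum: "(\<Sum>i\<in>I. f i) ^ (2 ^ k) = (\<Sum>i\<in>I. f i ^ (2 ^ k) :: 'a)"
  by (induction I rule: infinite_finite_induct) (simp_all add: power_two_power_add)

lemma power_q_add: "(x + y) ^ (q ^ i) = x ^ (q ^ i) + (y::'a) ^ (q ^ i)"
  by (simp add: q_def power_two_power_add flip: power_mult)

lemma bij_power_two_power: "bij (\<lambda>x::'a. x ^ (2 ^ k))"
proof -
  have "inj (\<lambda>x::'a. x ^ (2 ^ k))"
  proof (rule injI)
    fix x y :: 'a
    assume "x ^ (2 ^ k) = y ^ (2 ^ k)"
    then have "(x + y) ^ (2 ^ k) = 0" by (simp add: power_two_power_add)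
    then show "x = y" by (simp add: add_eq_0_iff_eq)
  qed
  then show ?thesis by (simp add: bij_betw_def finite_UNIV_inj_surj)
qed

lemma bij_power_q: "bij (\<lambda>x::'a. x ^ q)"
  using bij_power_two_power[of m] by (simp add: q_def)

text \<open>The map \<open>x ^ (2 ^ k)\<close> is injective and commutes with \<open>x ^ q\<close>,
  whose fixed points form \<open>K\<close>.\<close>

lemma power_two_power_in_K_iff: "x ^ (2 ^ k) \<in> K \<longleftrightarrow> x \<in> K"
proof -
  have "x ^ (2 ^ k) \<in> K \<longleftrightarrow> (x ^ q) ^ (2 ^ k) = x ^ (2 ^ k)"
    by (simp add: K_iff mult.commute flip: power_mult)
  also have "\<dots> \<longleftrightarrow> x ^ q = x"
    using bij_power_two_power[of k] by (auto simp: bij_def inj_def)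
  finally show ?thesis by (simp add: K_iff)
qed

section \<open>The relative and the absolute trace\<close>

definition Tr :: "'a \<Rightarrow> 'a" where
  "Tr x = (\<Sum>i<n. x ^ (q ^ i))"

text \<open>On \<open>K\<close> this is the absolute trace to the prime field. The formula is stated
  on the whole field, so the facts special to \<open>K\<close> carry a membership
  assumption.\<close>

definition tr2 :: "'a \<Rightarrow> 'a" where
  "tr2 x = (\<Sum>j<m. x ^ (2 ^ j))"

lemma Tr_0 [simp]: "Tr 0 = 0"
  using q_ge_2 by (simp add: Tr_def power_0_left)

lemma Tr_add: "Tr (x + y) = Tr x + Tr y"
  by (simp add: Tr_def power_q_add sum.distrib)

lemma Tr_sum: "Tr (sum f I) = (\<Sum>i\<in>I. Tr (f i))"
  by (induction I rule: infinite_finite_induct) (simp_all add: Tr_add)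

lemma Tr_power_q: "Tr (x ^ q) = Tr x"
proof -
  have "Tr (x ^ q) = (\<Sum>i<n. x ^ (q ^ Suc i))"
    by (simp add: Tr_def flip: power_mult)
  \<comment> \<open>Adding \<open>x\<close> completes the shifted sum to all exponents from 0 to
    \<open>n\<close>. The term at \<open>n\<close> is again \<open>x\<close>, so it cancels at the
    end.\<close>
  also have "\<dots> + x ^ (q ^ 0) = (\<Sum>i<Suc n. x ^ (q ^ i))"
    by (subst sum.lessThan_Suc_shift) simp
  also have "\<dots> = Tr x + x"
    by (simp add: Tr_def power_q_power_n)
  finally show ?thesis by simp
qed

lemma Tr_power_q_power: "Tr (x ^ (q ^ i)) = Tr x"
proof (induction i)
  case (Suc i)
  have "x ^ (q ^ Suc i) = (x ^ (q ^ i)) ^ q" by (simp add: mult.commute flip: power_mult)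
  then show ?case by (simp only: Tr_power_q Suc.IH)
qed simp

lemma Tr_power_two_power: "Tr (x ^ (2 ^ k)) = Tr x ^ (2 ^ k)"
  by (simp add: Tr_def power_two_power_sum mult.commute flip: power_mult)

lemma Tr_in_K [intro, simp]: "Tr x \<in> K"
  using Tr_power_two_power[of x m] Tr_power_q[of x] by (simp add: K_iff q_def)

lemma K_power_q_power: "c \<in> K \<Longrightarrow> c ^ (q ^ i) = c"
  by (induction i) (simp_all add: power_mult K_iff)

lemma Tr_scale: "c \<in> K \<Longrightarrow> Tr (c * x) = c * Tr x"
  by (simp add: Tr_def power_mult_distrib K_power_q_power sum_distrib_left)

lemma Tr_eq_1: "\<exists>e. Tr e = 1"
proof -
  have "card {x. Tr x = 0} < CARD('a)"
    unfolding Tr_def card_UNIV by (rule card_roots_sum_powers[OF q_ge_2 n])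
  then have "{x. Tr x = 0} \<noteq> UNIV" by (metis less_irrefl)
  then obtain x where "Tr x \<noteq> 0" by blast
  then have "Tr (inverse (Tr x) * x) = 1"
    using Tr_scale[of "inverse (Tr x)" x] by simp
  then show ?thesis ..
qed

text \<open>If \<open>a + b\<close> were nonzero, its multiples would exhaust the field and
  \<open>Tr\<close> would vanish everywhere.\<close>

lemma Tr_nondegenerate:
  assumes "\<And>y. Tr (a * y) = Tr (b * y)"
  shows "a = b"
proof (rule ccontr)
  assume "a \<noteq> b"
  then have nz: "a + b \<noteq> 0" by (simp add: add_eq_0_iff_eq)
  obtain e where "Tr e = 1" using Tr_eq_1 ..
  moreover have "Tr ((a + b) * (e / (a + b))) = 0"
    unfolding distrib_right Tr_add assms by simp
  ultimately show False using nz by simp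
qed

lemma tr2_0 [simp]: "tr2 0 = 0"
  by (simp add: tr2_def power_0_left)

lemma tr2_add: "tr2 (x + y) = tr2 x + tr2 y"
  by (simp add: tr2_def power_two_power_add sum.distrib)

lemma tr2_power2:
  assumes "x \<in> K"
  shows "tr2 (x\<^sup>2) = tr2 x"
proof -
  have "tr2 (x\<^sup>2) = (\<Sum>i<m. x ^ (2 ^ Suc i))"
    by (simp add: tr2_def flip: power_mult)
  also have "\<dots> + x ^ (2 ^ 0) = (\<Sum>i<Suc m. x ^ (2 ^ i))"
    by (subst sum.lessThan_Suc_shift) simp
  also have "\<dots> = tr2 x + x"
    using assms by (simp add: tr2_def K_iff flip: q_def)
  finally show ?thesis by simp
qed

lemma tr2_power_two_power: "x \<in> K \<Longrightarrow> tr2 (x ^ (2 ^ k)) = tr2 x"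
proof (induction k)
  case (Suc k)
  have "x ^ (2 ^ Suc k) = (x ^ (2 ^ k))\<^sup>2" by (simp add: mult.commute flip: power_mult)
  then show ?case using Suc by (simp only: tr2_power2 K_power)
qed simp

text \<open>Squaring is additive and only permutes the summands when \<open>x\<close> lies in
  \<open>K\<close>, so \<open>tr2 x\<close> equals its own square.\<close>

lemma tr2_cases:
  assumes "x \<in> K"
  shows "tr2 x = 0 \<or> tr2 x = 1"
proof -
  have "(tr2 x)\<^sup>2 = tr2 (x\<^sup>2)"
    using power_two_power_sum[where k = 1 and I = "{..<m}" and f = "\<lambda>j. x ^ (2 ^ j)"]
    by (simp add: tr2_def mult.commute flip: power_mult)
  then show ?thesis using tr2_power2[OF assms] by (simp add: power2_eq_square)
qed

lemma tr2_eq_1: "\<exists>k\<in>K. tr2 k = 1"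
proof (rule ccontr)
  assume "\<not> ?thesis"
  then have "K \<subseteq> {x. tr2 x = 0}" using tr2_cases by blast
  then have "card K \<le> card {x. tr2 x = 0}" by (intro card_mono) auto
  then show False
    using card_roots_sum_powers[where 'a = 'a, of 2 m] m by (simp add: tr2_def card_K q_def)
qed

section \<open>Additive characters and orthogonality\<close>

definition \<psi> :: "'a \<Rightarrow> int" where
  "\<psi> w = (if tr2 w = 0 then 1 else - 1)"

lemma \<psi>_0 [simp]: "\<psi> 0 = 1"
  by (simp add: \<psi>_def)

lemma \<psi>_nonzero [simp]: "\<psi> w \<noteq> 0"
  by (simp add: \<psi>_def)

lemma \<psi>_add: "v \<in> K \<Longrightarrow> w \<in> K \<Longrightarrow> \<psi> (v + w) = \<psi> v * \<psi> w"
  using tr2_cases[of v] tr2_cases[of w] by (auto simp: \<psi>_def tr2_add)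

lemma \<psi>_power_two_power: "v \<in> K \<Longrightarrow> \<psi> (v ^ (2 ^ k)) = \<psi> v"
  by (simp add: \<psi>_def tr2_power_two_power)

lemma sum_UNIV_shift: "(\<Sum>y\<in>UNIV. f (y + z)) = (\<Sum>y\<in>UNIV. f (y::'a) :: int)"
  by (rule sum.reindex_bij_betw) (rule bij_betwI[where g = "\<lambda>x. x - z"], auto)

text \<open>For nonzero \<open>s\<close>, a translation by an element of \<open>K\<close> flips the
  sign of every term, so the sum equals its own negative.\<close>

lemma sum_\<psi>_K:
  assumes s: "s \<in> K"
  shows "(\<Sum>k\<in>K. \<psi> (s * k)) = (if s = 0 then int q else 0)"
proof (cases "s = 0")
  case False
  obtain k0 where k0: "k0 \<in> K" "tr2 k0 = 1" using tr2_eq_1 by blast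
  let ?z = "k0 / s"
  have z: "?z \<in> K" using k0 s by auto
  have "(\<Sum>k\<in>K. \<psi> (s * k)) = (\<Sum>k\<in>K. \<psi> (s * (k + ?z)))"
    by (rule sum.reindex_bij_betw[symmetric], rule bij_betwI[where g = "\<lambda>k. k + ?z"])
      (use z in \<open>auto simp: add.assoc\<close>)
  also have "\<dots> = (\<Sum>k\<in>K. - \<psi> (s * k))"
  proof (rule sum.cong)
    fix k assume k: "k \<in> K"
    have "s * (k + ?z) = s * k + k0" using False by (simp add: distrib_left)
    then show "\<psi> (s * (k + ?z)) = - \<psi> (s * k)"
      using k s k0 by (simp add: \<psi>_add) (simp add: \<psi>_def)
  qed simp
  finally show ?thesis using False by (simp add: sum_negf)
qed (simp add: card_K)

lemma sum_\<psi>_Tr: "(\<Sum>y\<in>UNIV. \<psi> (Tr (c * y))) = (if c = 0 then int CARD('a) else 0)"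
proof (cases "c = 0")
  case False
  obtain k0 where k0: "k0 \<in> K" "tr2 k0 = 1" using tr2_eq_1 by blast
  obtain e where e: "Tr e = 1" using Tr_eq_1 ..
  \<comment> \<open>Chosen so that translating \<open>y\<close> by \<open>?z\<close> adds
    \<open>k0\<close> to the trace; since \<open>tr2 k0 = 1\<close>, every sign flips.\<close>
  let ?z = "k0 * e / c"
  have Tz: "Tr (c * ?z) = k0" using False e k0 Tr_scale[of k0 e] by simp
  have "(\<Sum>y\<in>UNIV. \<psi> (Tr (c * y))) = (\<Sum>y\<in>UNIV. \<psi> (Tr (c * (y + ?z))))"
    by (rule sum_UNIV_shift[symmetric])
  also have "\<dots> = (\<Sum>y\<in>UNIV. - \<psi> (Tr (c * y)))"
    unfolding distrib_left Tr_add Tz using k0 by (simp add: \<psi>_add) (simp add: \<psi>_def)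
  finally show ?thesis using False by (simp add: sum_negf)
qed simp

text \<open>For the converse, a missed value \<open>y\<close> makes \<open>f x + y\<close> nonzero
  for all \<open>x\<close>, so the double sum over \<open>x\<close> and \<open>u\<close> vanishes by
  orthogonality in \<open>u\<close>. Summing over \<open>x\<close> first leaves only
  \<open>u = 0\<close>, which contributes the size of the field.\<close>

lemma bij_iff_character_sums:
  "bij (f :: 'a \<Rightarrow> 'a) \<longleftrightarrow> (\<forall>u. u \<noteq> 0 \<longrightarrow> (\<Sum>x\<in>UNIV. \<psi> (Tr (u * f x))) = 0)"
proof
  assume "bij f"
  then have "(\<Sum>x\<in>UNIV. \<psi> (Tr (u * f x))) = (\<Sum>y\<in>UNIV. \<psi> (Tr (u * y)))" for u
    by (rule sum.reindex_bij_betw)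
  then show "\<forall>u. u \<noteq> 0 \<longrightarrow> (\<Sum>x\<in>UNIV. \<psi> (Tr (u * f x))) = 0"
    by (simp add: sum_\<psi>_Tr)
next
  assume *: "\<forall>u. u \<noteq> 0 \<longrightarrow> (\<Sum>x\<in>UNIV. \<psi> (Tr (u * f x))) = 0"
  have "y \<in> range f" for y
  proof (rule ccontr)
    assume "y \<notin> range f"
    then have "(\<Sum>x\<in>UNIV. \<Sum>u\<in>UNIV. \<psi> (Tr ((f x + y) * u))) = 0"
      by (intro sum.neutral) (auto simp: sum_\<psi>_Tr add_eq_0_iff_eq)
    moreover have "(\<Sum>x\<in>UNIV. \<Sum>u\<in>UNIV. \<psi> (Tr ((f x + y) * u)))
        = (\<Sum>u\<in>UNIV. \<psi> (Tr (u * y)) * (\<Sum>x\<in>UNIV. \<psi> (Tr (u * f x))))"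
      unfolding distrib_right Tr_add
      by (subst sum.swap) (simp add: sum_distrib_left \<psi>_add mult.commute)
    moreover have "\<dots> = (\<Sum>u\<in>(UNIV::'a set). if u = 0 then int CARD('a) else 0)"
      by (intro sum.cong) (use * in auto)
    ultimately show False by simp
  qed
  then have "surj f" by blast
  then show "bij f" by (simp add: bij_def finite_UNIV_surj_inj)
qed

section \<open>Evaluation of the quadratic character sum\<close>

lemma dual_pair:
  assumes B: "B \<notin> K"
  obtains e0 e1 where "Tr e0 = 1" "Tr (B * e0) = 0" "Tr e1 = 0" "Tr (B * e1) = 1"
proof -
  obtain e where e: "Tr e = 1" using Tr_eq_1 ..
  \<comment> \<open>The functionals \<open>Tr\<close> and \<open>\<lambda>y. Tr (B * y)\<close> are
    independent over \<open>K\<close>: if the second vanished on the kernel of the first, it would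
    be a \<open>K\<close>-multiple of it, and nondegeneracy would put \<open>B\<close> in
    \<open>K\<close>.\<close>
  have "\<exists>z. Tr z = 0 \<and> Tr (B * z) \<noteq> 0"
  proof (rule ccontr)
    assume *: "\<not> ?thesis"
    let ?c = "Tr (B * e)"
    have "Tr (B * y) = Tr (?c * y)" for y
    proof -
      have "Tr (y + Tr y * e) = 0" by (simp add: Tr_add Tr_scale e)
      then have "Tr (B * y + Tr y * (B * e)) = 0" using * by (metis distrib_left mult.left_commute)
      then have "Tr (B * y) = Tr y * ?c" by (simp add: Tr_add Tr_scale add_eq_0_iff_eq)
      then show ?thesis using Tr_scale[of ?c y] by (simp add: mult.commute)
    qed
    then have "B = ?c" by (rule Tr_nondegenerate)
    then show False using B Tr_in_K by metis
  qed
  then obtain z where z: "Tr z = 0" "Tr (B * z) \<noteq> 0" by blast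
  define e1 where "e1 = inverse (Tr (B * z)) * z"
  have e1: "Tr e1 = 0" "Tr (B * e1) = 1"
    using z Tr_scale[of "inverse (Tr (B * z))" z] Tr_scale[of "inverse (Tr (B * z))" "B * z"]
    by (simp_all add: e1_def mult.left_commute)
  \<comment> \<open>The multiple of \<open>e1\<close> cancels \<open>Tr (B * e)\<close> without
    disturbing the trace, because \<open>Tr e1 = 0\<close>.\<close>
  define e0 where "e0 = e + Tr (B * e) * e1"
  have "B * e0 = B * e + Tr (B * e) * (B * e1)" by (simp add: e0_def algebra_simps)
  then have "Tr (B * e0) = 0" by (simp add: Tr_add Tr_scale e1)
  moreover have "Tr e0 = 1" by (simp add: e0_def Tr_add Tr_scale e e1)
  ultimately show ?thesis using that e1 by blast
qed

text \<open>A relation in which \<open>a\<close> has a nonzero coefficient can be solved for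
  \<open>a\<close>; one without \<open>a\<close> but with \<open>B\<close> puts \<open>B\<close> in
  \<open>K\<close>. This yields the case split for the character sum.\<close>

lemma lin_indep_3_iff:
  "lin_indep_over K [1, a, B] \<longleftrightarrow> B \<notin> K \<and> \<not> (\<exists>\<alpha>\<in>K. \<exists>\<beta>\<in>K. a = \<alpha> + \<beta> * B)"
proof -
  have *: "lin_indep_over K [1, a, B] \<longleftrightarrow>
      (\<forall>x\<in>K. \<forall>y\<in>K. \<forall>z\<in>K. x + y * a + z * B = 0 \<longrightarrow> x = 0 \<and> y = 0 \<and> z = 0)"
    (is "?L \<longleftrightarrow> ?R")
  proof
    assume L: ?L
    show ?R
    proof (intro ballI impI)
      fix x y z assume "x \<in> K" "y \<in> K" "z \<in> K" "x + y * a + z * B = 0"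
      then show "x = 0 \<and> y = 0 \<and> z = 0"
        using L[unfolded lin_indep_over_def, THEN spec, of "\<lambda>i. [x, y, z] ! i"]
        by (simp add: All_less_Suc numeral_3_eq_3)
    qed
  qed (auto simp: lin_indep_over_def All_less_Suc numeral_3_eq_3)
  show ?thesis
  proof
    assume "lin_indep_over K [1, a, B]"
    then have R: "x = 0 \<and> y = 0 \<and> z = 0"
      if "x \<in> K" "y \<in> K" "z \<in> K" "x + y * a + z * B = 0" for x y z
      using that * by blast
    \<comment> \<open>In characteristic 2, an element \<open>B\<close> of \<open>K\<close> gives the
      relation with coefficients \<open>B\<close>, 0, 1.\<close>
    have "B \<notin> K" using R[of B 0 1] by auto
    moreover have "a \<noteq> \<alpha> + \<beta> * B" if "\<alpha> \<in> K" "\<beta> \<in> K" for \<alpha> \<beta>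
    proof
      assume "a = \<alpha> + \<beta> * B"
      then have "\<alpha> + 1 * a + \<beta> * B = 0" by (metis add.assoc add.commute add_self mult_1)
      then show False using R[of \<alpha> 1 \<beta>] that by auto
    qed
    ultimately show "B \<notin> K \<and> \<not> (\<exists>\<alpha>\<in>K. \<exists>\<beta>\<in>K. a = \<alpha> + \<beta> * B)" by blast
  next
    assume R: "B \<notin> K \<and> \<not> (\<exists>\<alpha>\<in>K. \<exists>\<beta>\<in>K. a = \<alpha> + \<beta> * B)"
    have "x = 0 \<and> y = 0 \<and> z = 0"
      if K: "x \<in> K" "y \<in> K" "z \<in> K" and eq: "x + y * a + z * B = 0" for x y z
    proof -
      have y: "y = 0"
      proof (rule ccontr)
        assume y: "y \<noteq> 0"
        have "y * a = x + z * B" using eq by (metis add.assoc add.commute add_eq_0_iff_eq)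
        then have "a = x / y + z / y * B" using y by (simp add: field_simps)
        then show False using R K by blast
      qed
      have z: "z = 0"
      proof (rule ccontr)
        assume z: "z \<noteq> 0"
        have "x = z * B" using eq y by (simp add: add_eq_0_iff_eq)
        then have "B = x / z" using z by simp
        then show False using R K by blast
      qed
      show ?thesis using eq y z by simp
    qed
    then show "lin_indep_over K [1, a, B]" using * by blast
  qed
qed

text \<open>Let \<open>b\<close> be the square root of \<open>B\<close>. The product of traces is
  the square of \<open>b * Tr y\<close>, and \<psi> is invariant under squaring on \<open>K\<close>,
  so orthogonality applies to \<open>a + b\<close>, whose square is
  \<open>a\<^sup>2 + B\<close>.\<close>

lemma character_sum_eq_0_iff_in_K:
  assumes B: "B \<in> K"
  shows "(\<Sum>y\<in>UNIV. \<psi> (Tr (a * y) + Tr y * Tr (B * y))) = 0 \<longleftrightarrow> a\<^sup>2 + B \<noteq> 0"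
proof -
  obtain b where b: "B = b\<^sup>2"
    using bij_power_two_power[of 1] by (auto simp: bij_def surj_def)
  have bK: "b \<in> K" using B power_two_power_in_K_iff[of b 1] by (simp add: b)
  have "\<psi> (Tr (a * y) + Tr y * Tr (B * y)) = \<psi> (Tr ((a + b) * y))" for y
  proof -
    have "Tr y * Tr (B * y) = (b * Tr y)\<^sup>2"
      using Tr_scale[OF B, of y] by (simp add: b power2_eq_square)
    then have "\<psi> (Tr y * Tr (B * y)) = \<psi> (b * Tr y)"
      using \<psi>_power_two_power[of "b * Tr y" 1] bK by simp
    then show ?thesis
      using bK by (simp add: \<psi>_add distrib_right Tr_add Tr_scale)
  qed
  moreover have "a\<^sup>2 + B = (a + b)\<^sup>2"
    using power_two_power_add[of a b 1] by (simp add: b)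
  ultimately show ?thesis by (simp add: sum_\<psi>_Tr)
qed

text \<open>Some \<open>z\<close> is killed by \<open>Tr\<close> and by
  \<open>\<lambda>y. Tr (B * y)\<close> but not by \<open>\<lambda>y. Tr (a * y)\<close>. Moving
  along \<open>z\<close> keeps the product of traces and changes only the linear part.\<close>

lemma character_sum_indep:
  assumes B: "B \<notin> K" and a: "\<not> (\<exists>\<alpha>\<in>K. \<exists>\<beta>\<in>K. a = \<alpha> + \<beta> * B)"
  shows "(\<Sum>y\<in>UNIV. \<psi> (Tr (a * y) + Tr y * Tr (B * y))) = 0"
proof -
  obtain e0 e1 where e: "Tr e0 = 1" "Tr (B * e0) = 0" "Tr e1 = 0" "Tr (B * e1) = 1"
    using dual_pair[OF B] .
  have "\<exists>z. Tr z = 0 \<and> Tr (B * z) = 0 \<and> Tr (a * z) \<noteq> 0"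
  proof (rule ccontr)
    assume *: "\<not> ?thesis"
    let ?\<alpha> = "Tr (a * e0)" and ?\<beta> = "Tr (a * e1)"
    have "Tr (a * y) = Tr ((?\<alpha> + ?\<beta> * B) * y)" for y
    proof -
      \<comment> \<open>This is the projection of \<open>y\<close> to the common kernel of both
        functionals along \<open>e0\<close> and \<open>e1\<close>.\<close>
      let ?z = "y + (Tr y * e0 + Tr (B * y) * e1)"
      have exp: "c * ?z = c * y + (Tr y * (c * e0) + Tr (B * y) * (c * e1))" for c
        by (simp add: algebra_simps)
      have "Tr ?z = 0" by (simp add: Tr_add Tr_scale e)
      moreover have "Tr (B * ?z) = 0" unfolding exp by (simp add: Tr_add Tr_scale e)
      ultimately have "Tr (a * ?z) = 0" using * by blast
      then have "Tr (a * y) = Tr y * ?\<alpha> + Tr (B * y) * ?\<beta>"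
        unfolding exp by (simp add: Tr_add Tr_scale add_eq_0_iff_eq)
      also have "\<dots> = Tr ((?\<alpha> + ?\<beta> * B) * y)"
        by (simp add: distrib_right Tr_add Tr_scale mult.assoc)
      finally show ?thesis .
    qed
    then have "a = ?\<alpha> + ?\<beta> * B" by (rule Tr_nondegenerate)
    then show False using a by blast
  qed
  then obtain z where z: "Tr z = 0" "Tr (B * z) = 0" "Tr (a * z) \<noteq> 0" by blast
  obtain k where k: "k \<in> K" "tr2 k = 1" using tr2_eq_1 by blast
  \<comment> \<open>Scales \<open>z\<close> so that the linear part grows by \<open>k\<close>, which
    has \<open>tr2 k = 1\<close>.\<close>
  define c where "c = k / Tr (a * z)"
  have c: "c \<in> K" using k by (simp add: c_def)
  have cz: "c * Tr (a * z) = k" using z by (simp add: c_def)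
  have shift: "Tr (d * (y + c * z)) = Tr (d * y) + c * Tr (d * z)" for d y
    using c by (simp add: distrib_left mult.left_commute[of d] Tr_add Tr_scale)
  have "(\<Sum>y\<in>UNIV. \<psi> (Tr (a * y) + Tr y * Tr (B * y)))
      = (\<Sum>y\<in>UNIV. \<psi> (Tr (a * (y + c * z)) + Tr (y + c * z) * Tr (B * (y + c * z))))"
    by (rule sum_UNIV_shift[symmetric])
  also have "\<dots> = (\<Sum>y\<in>UNIV. - \<psi> (Tr (a * y) + Tr y * Tr (B * y)))"
  proof (rule sum.cong)
    fix y
    have "Tr (a * (y + c * z)) + Tr (y + c * z) * Tr (B * (y + c * z))
        = (Tr (a * y) + Tr y * Tr (B * y)) + k"
      using shift[of 1 y] z by (simp add: shift cz add_ac)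
    then show "\<psi> (Tr (a * (y + c * z)) + Tr (y + c * z) * Tr (B * (y + c * z)))
        = - \<psi> (Tr (a * y) + Tr y * Tr (B * y))"
      using k by (simp add: \<psi>_add) (simp add: \<psi>_def)
  qed simp
  finally show ?thesis by (simp add: sum_negf)
qed

text \<open>Translating by \<open>k * e1\<close> fixes \<open>Tr y\<close> and adds \<open>k\<close>
  to \<open>Tr (B * y)\<close>. Summing over all \<open>k\<close> in \<open>K\<close> leaves only
  the \<open>y\<close> with \<open>Tr y = 0\<close>, each contributing \<open>q\<close>; among them
  is 0.\<close>

lemma character_sum_product_nonzero:
  assumes B: "B \<notin> K"
  shows "(\<Sum>y\<in>UNIV. \<psi> (Tr y * Tr (B * y))) \<noteq> 0"
proof -
  obtain e0 e1 where e: "Tr e0 = 1" "Tr (B * e0) = 0" "Tr e1 = 0" "Tr (B * e1) = 1"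
    using dual_pair[OF B] .
  let ?S = "\<Sum>y\<in>UNIV. \<psi> (Tr y * Tr (B * y))"
  have "int q * ?S = (\<Sum>k\<in>K. ?S)" by (simp add: card_K)
  also have "\<dots> = (\<Sum>k\<in>K. \<Sum>y\<in>UNIV. \<psi> (Tr y * Tr (B * y)) * \<psi> (Tr y * k))"
  proof (rule sum.cong)
    fix k assume k: "k \<in> K"
    have "?S = (\<Sum>y\<in>UNIV. \<psi> (Tr (y + k * e1) * Tr (B * (y + k * e1))))"
      by (rule sum_UNIV_shift[symmetric])
    also have "\<dots> = (\<Sum>y\<in>UNIV. \<psi> (Tr y * Tr (B * y)) * \<psi> (Tr y * k))"
      using k by (simp add: distrib_left mult.left_commute[of B] Tr_add Tr_scale e \<psi>_add)
    finally show "?S = \<dots>" .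
  qed simp
  also have "\<dots> = (\<Sum>y\<in>UNIV. \<psi> (Tr y * Tr (B * y)) * (\<Sum>k\<in>K. \<psi> (Tr y * k)))"
    by (subst sum.swap) (simp add: sum_distrib_left)
  also have "\<dots> = (\<Sum>y\<in>UNIV. if Tr y = 0 then int q else 0)"
    by (intro sum.cong) (auto simp: sum_\<psi>_K)
  also have "\<dots> > 0"
    by (intro sum_pos2[where i = 0]) (use q_ge_2 in auto)
  finally show ?thesis by auto
qed

text \<open>Completing the product: \<open>(Tr y + \<beta>) * (Tr (B * y) + \<alpha>)\<close> equals
  \<open>Tr (a * y) + Tr y * Tr (B * y) + \<alpha> * \<beta>\<close>, so up to the sign
  \<open>\<psi> (\<alpha> * \<beta>)\<close> the sum is the one without linear part.\<close>

lemma character_sum_dep: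
  assumes B: "B \<notin> K" and K: "\<alpha> \<in> K" "\<beta> \<in> K" and a: "a = \<alpha> + \<beta> * B"
  shows "(\<Sum>y\<in>UNIV. \<psi> (Tr (a * y) + Tr y * Tr (B * y))) \<noteq> 0"
proof -
  obtain e0 e1 where e: "Tr e0 = 1" "Tr (B * e0) = 0" "Tr e1 = 0" "Tr (B * e1) = 1"
    using dual_pair[OF B] .
  \<comment> \<open>The coefficients cross over: the shift of \<open>Tr y\<close> must be \<beta>
    and that of \<open>Tr (B * y)\<close> must be \<alpha>.\<close>
  let ?z = "\<beta> * e0 + \<alpha> * e1"
  have Tz: "Tr (y + ?z) = Tr y + \<beta>" for y
    using K by (simp add: Tr_add Tr_scale e)
  have TBz: "Tr (B * (y + ?z)) = Tr (B * y) + \<alpha>" for y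
    using K by (simp add: distrib_left mult.left_commute[of B] Tr_add Tr_scale e)
  have "(\<Sum>y\<in>UNIV. \<psi> (Tr y * Tr (B * y)))
      = (\<Sum>y\<in>UNIV. \<psi> (Tr (y + ?z) * Tr (B * (y + ?z))))"
    by (rule sum_UNIV_shift[symmetric])
  also have "\<dots> = (\<Sum>y\<in>UNIV. \<psi> (Tr (a * y) + Tr y * Tr (B * y)) * \<psi> (\<alpha> * \<beta>))"
  proof (rule sum.cong)
    fix y
    have "Tr (a * y) = \<alpha> * Tr y + \<beta> * Tr (B * y)"
      using K by (simp add: a distrib_right Tr_add Tr_scale mult.assoc)
    then have "Tr (y + ?z) * Tr (B * (y + ?z)) = (Tr (a * y) + Tr y * Tr (B * y)) + \<alpha> * \<beta>"
      unfolding Tz TBz by (simp add: algebra_simps)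
    then show "\<psi> (Tr (y + ?z) * Tr (B * (y + ?z)))
        = \<psi> (Tr (a * y) + Tr y * Tr (B * y)) * \<psi> (\<alpha> * \<beta>)"
      using K by (simp add: \<psi>_add)
  qed simp
  also have "\<dots> = (\<Sum>y\<in>UNIV. \<psi> (Tr (a * y) + Tr y * Tr (B * y))) * \<psi> (\<alpha> * \<beta>)"
    by (simp add: sum_distrib_right)
  finally show ?thesis using character_sum_product_nonzero[OF B] by auto
qed

lemma character_sum_eq_0_iff:
  "(\<Sum>y\<in>UNIV. \<psi> (Tr (a * y) + Tr y * Tr (B * y))) = 0 \<longleftrightarrow>
    (B \<in> K \<and> a\<^sup>2 + B \<noteq> 0) \<or> lin_indep_over K [1, a, B]"
proof (cases "B \<in> K")
  case True
  then show ?thesis by (simp only: character_sum_eq_0_iff_in_K lin_indep_3_iff) simp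
next
  case False
  then show ?thesis
    using character_sum_indep[OF False, of a] character_sum_dep[OF False, of _ _ a]
    unfolding lin_indep_3_iff by blast
qed

section \<open>Adjoints and reduction to the character sum\<close>

lemma Tr_adjoint:
  assumes "q_linear q L"
  shows "Tr (u * poly L y) = Tr (q_adjoint q L u * y)"
proof -
  obtain k a where L: "L = (\<Sum>i<k. monom (a i) (q ^ i))"
    using assms by (auto simp: q_linear_def)
  let ?g = "inv (\<lambda>y::'a. y ^ q)"
  have g: "(?g ^^ i) x ^ (q ^ i) = x" for i x
  proof (induction i arbitrary: x)
    case (Suc i)
    have "(?g ^^ Suc i) x ^ (q ^ Suc i) = ((?g ^^ i) (?g x) ^ (q ^ i)) ^ q"
      by (simp add: funpow_swap1 mult.commute flip: power_mult)
    also have "\<dots> = x" using Suc.IH surj_f_inv_f[OF bij_is_surj[OF bij_power_q]] by simp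
    finally show ?case .
  qed simp
  have "Tr (u * poly L y) = (\<Sum>i<k. Tr (u * (a i * y ^ (q ^ i))))"
    by (simp add: L poly_sum poly_monom sum_distrib_left Tr_sum)
  also have "\<dots> = (\<Sum>i<k. Tr ((?g ^^ i) (a i * u) * y))"
  proof (rule sum.cong)
    fix i
    \<comment> \<open>Each summand is a \<open>q ^ i\<close>-th power, and \<open>Tr\<close> does
      not see such powers; extracting the root produces the summand of the adjoint.\<close>
    have "u * (a i * y ^ (q ^ i)) = ((?g ^^ i) (a i * u) * y) ^ (q ^ i)"
      by (simp add: power_mult_distrib g)
    then show "Tr (u * (a i * y ^ (q ^ i))) = Tr ((?g ^^ i) (a i * u) * y)"
      by (simp only: Tr_power_q_power)
  qed simp
  also have "\<dots> = Tr (q_adjoint q L u * y)"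
    by (simp add: L q_adjoint_eq[OF q_ge_2 bij_power_q] sum_distrib_right Tr_sum)
  finally show ?thesis .
qed

text \<open>After passing to adjoints, the linear term involves \<open>x ^ (2 ^ l)\<close> but the
  product of traces involves \<open>x\<close>. Raising that product to the power
  \<open>2 ^ l\<close> leaves \<psi> unchanged and makes everything a function of
  \<open>x ^ (2 ^ l)\<close>, which runs through the whole field.\<close>

lemma character_sum_poly:
  assumes "q_linear q L0" "q_linear q L1"
  shows "(\<Sum>x\<in>UNIV. \<psi> (Tr (u * poly (pcompose L0 (monom 1 (2 ^ l)) + L1 * trace_poly q n) x)))
    = (\<Sum>y\<in>UNIV. \<psi> (Tr (q_adjoint q L0 u * y) + Tr y * Tr (q_adjoint q L1 u ^ (2 ^ l) * y)))"
proof -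
  let ?a = "q_adjoint q L0 u" and ?b = "q_adjoint q L1 u"
  have "\<psi> (Tr (u * poly (pcompose L0 (monom 1 (2 ^ l)) + L1 * trace_poly q n) x))
      = \<psi> (Tr (?a * x ^ (2 ^ l)) + Tr (x ^ (2 ^ l)) * Tr (?b ^ (2 ^ l) * x ^ (2 ^ l)))" for x
  proof -
    have tr: "poly (trace_poly q n) x = Tr x"
      by (simp add: trace_poly_def Tr_def poly_sum poly_monom)
    have "Tr (u * poly (pcompose L0 (monom 1 (2 ^ l)) + L1 * trace_poly q n) x)
        = Tr (u * poly L0 (x ^ (2 ^ l)) + Tr x * (u * poly L1 x))"
      by (simp add: poly_pcompose poly_monom tr algebra_simps)
    also have "\<dots> = Tr (?a * x ^ (2 ^ l)) + Tr x * Tr (?b * x)"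
      by (simp add: Tr_add Tr_scale Tr_adjoint assms)
    finally have "\<psi> (Tr (u * poly (pcompose L0 (monom 1 (2 ^ l)) + L1 * trace_poly q n) x))
        = \<psi> (Tr (?a * x ^ (2 ^ l))) * \<psi> ((Tr x * Tr (?b * x)) ^ (2 ^ l))"
      by (simp only: \<psi>_add \<psi>_power_two_power Tr_in_K K_mult)
    also have "(Tr x * Tr (?b * x)) ^ (2 ^ l)
        = Tr (x ^ (2 ^ l)) * Tr (?b ^ (2 ^ l) * x ^ (2 ^ l))"
      by (simp add: power_mult_distrib Tr_power_two_power[symmetric])
    finally show ?thesis by (simp add: \<psi>_add)
  qed
  then show ?thesis
    using sum.reindex_bij_betw[OF bij_power_two_power[of l],
        of "\<lambda>y. \<psi> (Tr (?a * y) + Tr y * Tr (?b ^ (2 ^ l) * y))"]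
    by simp
qed

end

theorem theorem12:
  fixes K :: "'a::{field, finite} set"
    and L\<^sub>0 L\<^sub>1 :: "'a poly"
    and q n l :: nat
  assumes "\<exists>m\<ge>1. q = 2 ^ m"
    and "n \<ge> 1"
    and "CARD('a) = q ^ n"
    and "is_subfield K" and "card K = q"
    and "q_linear q L\<^sub>0" and "q_linear q L\<^sub>1"
  shows "permutation_poly (pcompose L\<^sub>0 (monom 1 (2 ^ l)) + L\<^sub>1 * trace_poly q n) \<longleftrightarrow>
    (\<forall>u. u \<noteq> 0 \<longrightarrow>
       (q_adjoint q L\<^sub>1 u \<in> K \<and> (q_adjoint q L\<^sub>0 u)\<^sup>2 + q_adjoint q L\<^sub>1 u ^ (2 ^ l) \<noteq> 0) \<or>
       lin_indep_over K [1, q_adjoint q L\<^sub>0 u, q_adjoint q L\<^sub>1 u ^ (2 ^ l)])"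
proof -
  obtain m where "m \<ge> 1" "q = 2 ^ m" using assms(1) by blast
  then interpret even_field_extension K q m n
    using assms by unfold_locales
  \<comment> \<open>The character sum yields a condition on membership of
    \<open>q_adjoint q L\<^sub>1 u ^ (2 ^ l)\<close> in \<open>K\<close>; the last rewriting removes
    the exponent.\<close>
  show ?thesis
    unfolding permutation_poly_def bij_iff_character_sums
      character_sum_poly[OF assms(6,7)] character_sum_eq_0_iff power_two_power_in_K_iff ..
qed

end
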